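(* Let $\alpha,\beta,\gamma\in\mathbb{C}$. Then, as Riordan arrays, $$\left(\frac{1-\beta x}{1+\alpha x-\beta\gamma x^2},\ \frac{x(1-\beta x)}{1+\alpha x-\beta\gamma x^2}\right)=\tilde B\cdot\left(\frac{1+\beta x}{1+(\alpha+2\beta)x+\beta(\alpha+\beta-\gamma)x^2},\ \frac{x}{1+(\alpha+2\beta)x+\beta(\alpha+\beta-\gamma)x^2}\right),$$ where $$\tilde B=\left(1,\ \frac{x}{1-\beta x}\right).$$
   Context: For formal power series $g(x)=1+g_1x+\cdots$ and $f(x)=x+f_2x^2+\cdots$, the Riordan array $(g,f)$ is the infinite lower-triangular matrix (indices from $0$) whose $(n,k)$ entry is $[x^n]\,g(x)f(x)^k$. The product is the matrix product, equivalently $(g,f)\cdot(h,l)=(g\cdot(h\circ f),\,l\circ f)$. *)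

theory Defs
  imports Complex_Main "HOL-Computational_Algebra.Formal_Power_Series"
begin

text \<open>
  Infinite matrices are functions \<open>nat \<Rightarrow> nat \<Rightarrow> complex\<close> (row, then column, both from 0).
\<close>

definition riordan :: "complex fps \<Rightarrow> complex fps \<Rightarrow> nat \<Rightarrow> nat \<Rightarrow> complex" where
  "riordan g f = (\<lambda>n k. fps_nth (g * f ^ k) n)"

definition riordan_pair :: "complex fps \<Rightarrow> complex fps \<Rightarrow> bool" where
  "riordan_pair g f \<longleftrightarrow> fps_nth g 0 = 1 \<and> fps_nth f 0 = 0 \<and> fps_nth f 1 = 1"

text \<open>
  The matrix product. Row \<open>n\<close> of a lower-triangular left factor vanishes beyond column \<open>n\<close>,
  so summing over \<open>j \<le> n\<close> loses nothing; see \<open>riordan_lower_triangular\<close>.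
\<close>

definition lt_mult ::
  "(nat \<Rightarrow> nat \<Rightarrow> complex) \<Rightarrow> (nat \<Rightarrow> nat \<Rightarrow> complex) \<Rightarrow> nat \<Rightarrow> nat \<Rightarrow> complex" (infixl "\<odot>" 70) where
  "A \<odot> B = (\<lambda>n k. \<Sum>j\<le>n. A n j * B j k)"

lemma riordan_lower_triangular:
  assumes "riordan_pair g f" and "n < k"
  shows "riordan g f n k = 0"
proof -
  have "fps_nth f 0 = 0"
    using assms by (simp add: riordan_pair_def)
  then have "fps_nth (f ^ k) i = 0" if "i \<le> n" for i
    using that assms(2) startsby_zero_power_prefix[of f k] by auto
  then show ?thesis
    by (simp add: riordan_def fps_mult_nth)
qed

text \<open>
  The quotients below have denominators with constant term 1, hence are genuine
  power series quotients, and all three pairs are normalised as Riordan arrays require.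
\<close>

lemma riordan_pair_lhs:
  fixes \<alpha> \<beta> \<gamma> :: complex
  defines "D \<equiv> 1 + fps_const \<alpha> * fps_X - fps_const (\<beta> * \<gamma>) * fps_X ^ 2"
  shows "riordan_pair ((1 - fps_const \<beta> * fps_X) / D) (fps_X * (1 - fps_const \<beta> * fps_X) / D)"
  by (simp add: riordan_pair_def D_def fps_divide_unit fps_mult_nth_1 mult.assoc power2_eq_square)

lemma riordan_pair_left_factor:
  "riordan_pair 1 (fps_X / (1 - fps_const (\<beta> :: complex) * fps_X))"
  by (simp add: riordan_pair_def fps_divide_unit)

lemma riordan_pair_right_factor:
  fixes \<alpha> \<beta> \<gamma> :: complex
  defines "E \<equiv> 1 + fps_const (\<alpha> + 2 * \<beta>) * fps_X
                + fps_const (\<beta> * (\<alpha> + \<beta> - \<gamma>)) * fps_X ^ 2"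
  shows "riordan_pair ((1 + fps_const \<beta> * fps_X) / E) (fps_X / E)"
  by (simp add: riordan_pair_def E_def fps_divide_unit)

end

theory Submission
  imports Defs
begin

text \<open>
  Let \<open>F\<close> be the second component of the left factor. By the multiplication rule for Riordan
  arrays (\<open>riordan_mult\<close>), the claim amounts to substituting \<open>F\<close> into the two components of the
  right factor. With \<open>u = 1 - \<beta>x\<close> one has \<open>F u = x\<close>, so \<open>1 + \<beta>F = 1 / u\<close>, and the quadratic
  in the denominators becomes
  \<open>(u\<^sup>2 + (\<alpha> + 2\<beta>) x u + \<beta>(\<alpha> + \<beta> - \<gamma>) x\<^sup>2) / u\<^sup>2 = (1 + \<alpha>x - \<beta>\<gamma>x\<^sup>2) / u\<^sup>2\<close>
  (\<open>quadratic_substitution\<close>). The two resulting quotients are the components on the left.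
\<close>

text \<open>
  The entry \<open>(n, k)\<close> of the product is \<open>[x\<^sup>n] g \<Sum>\<^sub>j a\<^sub>j f\<^sup>j\<close> with \<open>a = h l\<^sup>k\<close>, where the terms
  with \<open>j > n\<close> vanish because \<open>f\<^sup>j\<close> is divisible by \<open>x\<^sup>j\<close>. The sum is \<open>a\<close> composed with \<open>f\<close>,
  and composition is multiplicative.
\<close>
lemma riordan_mult:
  assumes "fps_nth f 0 = 0"
  shows "riordan g f \<odot> riordan h l = riordan (g * (h oo f)) (l oo f)"
proof (intro ext)
  fix n k
  define a where "a = h * l ^ k"
  have comp: "fps_nth (a oo f) i = (\<Sum>j\<le>n. fps_nth a j * fps_nth (f ^ j) i)" if "i \<le> n" for i
    unfolding fps_compose_nth
  proof (rule sum.mono_neutral_left)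
    show "\<forall>j\<in>{..n} - {0..i}. fps_nth a j * fps_nth (f ^ j) i = 0"
      using startsby_zero_power_prefix[OF assms] by auto
  qed (use that in auto)
  have "(riordan g f \<odot> riordan h l) n k
      = (\<Sum>j\<le>n. \<Sum>i=0..n. fps_nth g i * (fps_nth a j * fps_nth (f ^ j) (n - i)))"
    by (simp add: lt_mult_def riordan_def a_def[symmetric] fps_mult_nth[of g] sum_distrib_left
        sum_distrib_right mult_ac)
  also have "\<dots> = (\<Sum>i=0..n. fps_nth g i * fps_nth (a oo f) (n - i))"
    by (subst sum.swap) (simp add: comp sum_distrib_left)
  also have "\<dots> = fps_nth (g * (a oo f)) n"
    by (simp add: fps_mult_nth)
  also have "a oo f = (h oo f) * (l oo f) ^ k"
    by (simp add: a_def fps_compose_mult_distrib[OF assms] fps_compose_power[OF assms])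
  finally show "(riordan g f \<odot> riordan h l) n k = riordan (g * (h oo f)) (l oo f) n k"
    by (simp add: riordan_def mult.assoc)
qed

lemma fps_divide_eq_divideI:
  fixes a b c d :: "'a::field fps"
  assumes "fps_nth b 0 \<noteq> 0" "fps_nth d 0 \<noteq> 0" "a * d = c * b"
  shows "a / b = c / d"
proof -
  have "a / b = a * (d * inverse d) * inverse b"
    by (simp add: fps_divide_unit inverse_mult_eq_1' assms(1,2))
  also have "\<dots> = (c * b) * inverse d * inverse b"
    by (simp add: assms(3)[symmetric] mult.assoc)
  also have "\<dots> = c * inverse d * (b * inverse b)"
    by (simp only: mult_ac)
  also have "\<dots> = c / d"
    by (simp add: fps_divide_unit inverse_mult_eq_1' assms(1,2))
  finally show ?thesis .
qed

text \<open>
  Multiplying by \<open>(1 - b x)\<^sup>2\<close> turns the powers of \<open>F\<close> into powers of \<open>x\<close>. The coefficients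
  \<open>a + 2 b\<close> and \<open>b (a + b - c)\<close> are those for which the expansion of \<open>(1 - b x)\<^sup>2\<close> cancels,
  leaving the linear term \<open>a x\<close> and the quadratic term \<open>- b c x\<^sup>2\<close>.
\<close>
lemma quadratic_substitution:
  fixes F x a b c :: "'a::comm_ring_1"
  assumes "F * (1 - b * x) = x"
  shows "(1 + (a + 2 * b) * F + b * (a + b - c) * F ^ 2) * (1 - b * x) ^ 2
       = 1 + a * x - b * c * x ^ 2"
proof -
  define u where "u = 1 - b * x"
  have "(1 + (a + 2 * b) * F + b * (a + b - c) * F ^ 2) * u ^ 2
      = u ^ 2 + (a + 2 * b) * (F * u) * u + b * (a + b - c) * (F * u) ^ 2"
    by (simp add: algebra_simps power2_eq_square)
  also have "F * u = x"
    using assms by (simp add: u_def)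
  finally show ?thesis
    by (simp add: u_def algebra_simps power2_eq_square)
qed

theorem proposition16:
  fixes \<alpha> \<beta> \<gamma> :: complex
  shows "riordan
           ((1 - fps_const \<beta> * fps_X)
              / (1 + fps_const \<alpha> * fps_X - fps_const (\<beta> * \<gamma>) * fps_X ^ 2))
           (fps_X * (1 - fps_const \<beta> * fps_X)
              / (1 + fps_const \<alpha> * fps_X - fps_const (\<beta> * \<gamma>) * fps_X ^ 2))
         = riordan 1 (fps_X / (1 - fps_const \<beta> * fps_X))
           \<odot> riordan
             ((1 + fps_const \<beta> * fps_X)
                / (1 + fps_const (\<alpha> + 2 * \<beta>) * fps_X
                     + fps_const (\<beta> * (\<alpha> + \<beta> - \<gamma>)) * fps_X ^ 2))
             (fps_X
                / (1 + fps_const (\<alpha> + 2 * \<beta>) * fps_X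
                     + fps_const (\<beta> * (\<alpha> + \<beta> - \<gamma>)) * fps_X ^ 2))"
proof -
  define u :: "complex fps" where "u = 1 - fps_const \<beta> * fps_X"
  define F where "F = fps_X / u"
  define D where "D = 1 + fps_const \<alpha> * fps_X - fps_const (\<beta> * \<gamma>) * fps_X ^ 2"
  define E where "E = 1 + fps_const (\<alpha> + 2 * \<beta>) * fps_X
                       + fps_const (\<beta> * (\<alpha> + \<beta> - \<gamma>)) * fps_X ^ 2"
  have u0: "fps_nth u 0 = 1" and D0: "fps_nth D 0 = 1" and E0: "fps_nth E 0 = 1"
    by (simp_all add: u_def D_def E_def)
  have F0: "fps_nth F 0 = 0"
    by (simp add: F_def fps_divide_unit u0)
  have Fu: "F * u = fps_X"
    by (simp add: F_def fps_divide_unit u0 mult.assoc inverse_mult_eq_1)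
  have EF: "E oo F = 1 + fps_const (\<alpha> + 2 * \<beta>) * F + fps_const (\<beta> * (\<alpha> + \<beta> - \<gamma>)) * F ^ 2"
    by (simp add: E_def fps_compose_add_distrib fps_compose_mult_distrib[OF F0]
        fps_compose_power[OF F0, symmetric] F0)
  have "fps_const (\<alpha> + 2 * \<beta>) = fps_const \<alpha> + 2 * fps_const \<beta>"
       "fps_const (\<beta> * (\<alpha> + \<beta> - \<gamma>)) = fps_const \<beta> * (fps_const \<alpha> + fps_const \<beta> - fps_const \<gamma>)"
    by (simp_all add: numeral_fps_const)
  then have EF_D: "(E oo F) * u ^ 2 = D"
    using quadratic_substitution[of F "fps_const \<beta>" fps_X "fps_const \<alpha>" "fps_const \<gamma>"] Fu
    by (simp add: EF u_def D_def)
  have "((1 + fps_const \<beta> * fps_X) / E) oo F = (1 + fps_const \<beta> * F) / (E oo F)"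
    using F0 E0
    by (subst fps_divide_compose)
       (simp_all add: fps_compose_add_distrib fps_compose_mult_distrib[OF F0])
  also have "\<dots> = u / D"
  proof (rule fps_divide_eq_divideI)
    have "(1 + fps_const \<beta> * F) * u = 1"
      by (simp add: distrib_right mult.assoc Fu) (simp add: u_def)
    then show "(1 + fps_const \<beta> * F) * D = u * (E oo F)"
      unfolding EF_D[symmetric] by (metis (no_types) mult.assoc mult.commute mult_1 power2_eq_square)
  qed (simp_all add: E0 D0)
  finally have g: "((1 + fps_const \<beta> * fps_X) / E) oo F = u / D" .
  have "(fps_X / E) oo F = F / (E oo F)"
    using F0 E0 by (subst fps_divide_compose) simp_all
  also have "\<dots> = fps_X * u / D"
  proof (rule fps_divide_eq_divideI)
    show "F * D = fps_X * u * (E oo F)"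
      unfolding EF_D[symmetric] Fu[symmetric] by (simp add: power2_eq_square mult_ac)
  qed (simp_all add: E0 D0)
  finally have f: "(fps_X / E) oo F = fps_X * u / D" .
  have "riordan 1 F \<odot> riordan ((1 + fps_const \<beta> * fps_X) / E) (fps_X / E)
      = riordan (u / D) (fps_X * u / D)"
    by (simp add: riordan_mult[OF F0] f g)
  then show ?thesis
    by (simp add: u_def F_def D_def E_def)
qed

end
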